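(* Let $G\rightrightarrows Q$ be a Lie groupoid with Lie algebroid $AG\to Q$, let $H$ be a Lie group, and let $(\Phi,\phi)$ be a free and proper action of $H$ on $G\rightrightarrows Q$ by Lie groupoid isomorphisms. Let $\mathcal R\colon AG\to G$ be an $H$-equivariant generalized discretization map on $G$, i.e. $\mathcal R\circ A\Phi_{\mathbf h}=\Phi_{\mathbf h}\circ\mathcal R$ for all $\mathbf h\in H$. Let $\widehat{AG}=AG/H$, $\widehat G=G/H$, $\widehat Q=Q/H$, and let $\widehat{\mathcal R}\colon\widehat{AG}\to\widehat G$ be the smooth map induced by $\mathcal R$, characterized by $\widehat{\mathcal R}\circ\pi_{AG}=\pi_G\circ\mathcal R$, where $\pi_{AG}\colon AG\to\widehat{AG}$ and $\pi_G\colon G\to\widehat G$ are the canonical projections. Then $\widehat{\mathcal R}$ is a generalized discretization map on the quotient Lie groupoid $\widehat G\rightrightarrows\widehat Q$.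
   Context: Conventions: for a Lie groupoid $G\rightrightarrows Q$ with source $\alpha$, target $\beta$ and identity section $\epsilon\colon Q\to G$, the product $gh$ is defined when $\beta(g)=\alpha(h)$. The Lie algebroid $\tau\colon AG\to Q$ has fibers $A_qG=\ker T_{\epsilon(q)}\alpha\subset T_{\epsilon(q)}G$; a Lie groupoid morphism $(\Psi,\psi)$ induces a Lie algebroid morphism $A\Psi(v_q)=T_{\epsilon(q)}\Psi(v_q)$ for $v_q\in A_qG$. Let $0_{AG}\colon Q\to AG$ be the zero section, and for $v_q\in A_qG$ let $(v_q)^{\mathtt v}_{0_{AG}(q)}=\frac{d}{dt}\big|_{t=0}(tv_q)\in T_{0_{AG}(q)}(A_qG)$ be the vertical lift. A smooth map $\mathcal R\colon AG\to G$ is a generalized discretization map on $G$ if: (1) $\mathcal R\circ 0_{AG}=\epsilon$; (2) writing $\mathcal R_q=\mathcal R|_{A_qG}$, $$\left(T_{0_{AG}(q)}\mathcal R_q\right)\left((v_q)^{\mathtt v}_{0_{AG}(q)}\right)=v_q+\left[T_q\epsilon\circ T_{\epsilon(q)}\alpha\circ T_{0_{AG}(q)}\mathcal R_q\right]\left((v_q)^{\mathtt v}_{0_{AG}(q)}\right)$$ for all $q\in Q$ and $v_q\in A_qG$. An action $(\Phi,\phi)$ of $H$ on $G\rightrightarrows Q$ by Lie groupoid isomorphisms consists of smooth actions $\Phi\colon H\times G\to G$ and $\phi\colon H\times Q\to Q$ such that $(\Phi_{\mathbf h},\phi_{\mathbf h})$ is a Lie groupoid isomorphism for each $\mathbf h\in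 H$; here $\phi$ is free and proper (hence so are $\Phi$ and the induced action $A\Phi$ of $H$ on $AG$). The quotient $\widehat G\rightrightarrows\widehat Q$ is a Lie groupoid with structural maps induced from those of $G$ through the canonical projections $\pi_G$ and $\pi_Q\colon Q\to\widehat Q$, and its Lie algebroid is identified with $\widehat{AG}=AG/H\to\widehat Q$, with $\pi_{AG}$ corresponding to $A\pi_G$. *)

theory Defs
  imports "HOL-Analysis.Analysis" "HOL-Algebra.Group"
begin

section \<open>Smooth manifolds\<close>

text \<open>
  Iterated differentiability through directional derivatives. For finite-dimensional domains and
  open \<open>U\<close> this is the usual notion of a \<open>C\<^sup>k\<close> map; all model spaces below are finite-dimensional.
\<close>

fun Ck_on :: "nat \<Rightarrow> 'a::real_normed_vector set \<Rightarrow> ('a \<Rightarrow> 'b::real_normed_vector) \<Rightarrow> bool" where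
  "Ck_on 0 U f \<longleftrightarrow> continuous_on U f"
| "Ck_on (Suc k) U f \<longleftrightarrow>
     (\<forall>x\<in>U. f differentiable (at x)) \<and> (\<forall>v. Ck_on k U (\<lambda>x. frechet_derivative f (at x) v))"

definition Cinf_on :: "'a::real_normed_vector set \<Rightarrow> ('a \<Rightarrow> 'b::real_normed_vector) \<Rightarrow> bool" where
  "Cinf_on U f \<longleftrightarrow> (\<forall>k. Ck_on k U f)"

text \<open>
  The underlying set of a manifold is the \<open>topspace\<close> of its topology. A chart is a pair of its
  domain and a coordinate map, whose values outside the domain are irrelevant.
\<close>

record ('a, 'e) smfd =
  mtop :: "'a topology"
  atlas :: "('a set \<times> ('a \<Rightarrow> 'e)) set"

abbreviation points :: "('a, 'e) smfd \<Rightarrow> 'a set" where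
  "points M \<equiv> topspace (mtop M)"

text \<open>
  The model space is a finite-dimensional normed space rather than a type of class
  \<open>euclidean_space\<close>, because the latter has dimension at least one and would rule out
  zero-dimensional manifolds, such as the base of a Lie group seen as a Lie groupoid.
\<close>

definition smooth_manifold :: "('a, 'e::real_normed_vector) smfd \<Rightarrow> bool" where
  "smooth_manifold M \<longleftrightarrow>
     (\<exists>B::'e set. finite B \<and> span B = UNIV) \<and>
     Hausdorff_space (mtop M) \<and> second_countable (mtop M) \<and>
     (\<Union>(U, \<phi>)\<in>atlas M. U) = points M \<and>
     (\<forall>(U, \<phi>)\<in>atlas M. openin (mtop M) U \<and> open (\<phi> ` U) \<and>
        homeomorphic_map (subtopology (mtop M) U) (top_of_set (\<phi> ` U)) \<phi>) \<and>
     (\<forall>(U, \<phi>)\<in>atlas M. \<forall>(V, \<psi>)\<in>atlas M. Cinf_on (\<phi> ` (U \<inter> V)) (\<psi> \<circ> inv_into U \<phi>))"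

definition smooth_on_open ::
  "('a, 'e::real_normed_vector) smfd \<Rightarrow> 'a set \<Rightarrow> ('b, 'f::real_normed_vector) smfd \<Rightarrow> ('a \<Rightarrow> 'b) \<Rightarrow> bool" where
  "smooth_on_open M W N f \<longleftrightarrow>
     openin (mtop M) W \<and> continuous_map (subtopology (mtop M) W) (mtop N) f \<and>
     (\<forall>(U, \<phi>)\<in>atlas M. \<forall>(V, \<psi>)\<in>atlas N.
        Cinf_on (\<phi> ` {p \<in> U \<inter> W. f p \<in> V}) (\<psi> \<circ> f \<circ> inv_into U \<phi>))"

definition smooth_map ::
  "('a, 'e::real_normed_vector) smfd \<Rightarrow> ('b, 'f::real_normed_vector) smfd \<Rightarrow> ('a \<Rightarrow> 'b) \<Rightarrow> bool" where
  "smooth_map M N f \<longleftrightarrow> smooth_on_open M (points M) N f"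

text \<open>
  Smoothness on a subset, by local smooth extensions. On an embedded submanifold this agrees with
  smoothness for the submanifold structure. It is used for the composable pairs inside \<open>G \<times> G\<close> and
  for the Lie algebroid inside the tangent bundle \<open>TG\<close>, which are embedded submanifolds because
  source and target are submersions.
\<close>

definition smooth_on_subset ::
  "('a, 'e::real_normed_vector) smfd \<Rightarrow> 'a set \<Rightarrow> ('b, 'f::real_normed_vector) smfd \<Rightarrow> ('a \<Rightarrow> 'b) \<Rightarrow> bool" where
  "smooth_on_subset M S N f \<longleftrightarrow> S \<subseteq> points M \<and>
     (\<forall>p\<in>S. \<exists>W F. p \<in> W \<and> smooth_on_open M W N F \<and> (\<forall>x\<in>W \<inter> S. F x = f x))"

definition prod_smfd ::
  "('a, 'e) smfd \<Rightarrow> ('b, 'f) smfd \<Rightarrow> ('a \<times> 'b, 'e \<times> 'f) smfd" where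
  "prod_smfd M N = \<lparr> mtop = prod_topology (mtop M) (mtop N),
     atlas = {(U \<times> V, map_prod \<phi> \<psi>) | U \<phi> V \<psi>. (U, \<phi>) \<in> atlas M \<and> (V, \<psi>) \<in> atlas N} \<rparr>"


section \<open>Tangent vectors\<close>

text \<open>
  A chart around each point is chosen once and for all, and the tangent space at \<open>p\<close> is identified
  with the model space \<open>'e\<close> through the chart chosen at \<open>p\<close>. Hence a tangent vector is a pair
  \<open>(p, v) :: 'a \<times> 'e\<close>, and \<open>tangent_map M N f p\<close> is the linear map \<open>T\<^sub>pf\<close> in these identifications.
\<close>

definition chart_at :: "('a, 'e) smfd \<Rightarrow> 'a \<Rightarrow> 'a set \<times> ('a \<Rightarrow> 'e)" where
  "chart_at M p = (SOME c. c \<in> atlas M \<and> p \<in> fst c)"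

abbreviation coord_at :: "('a, 'e) smfd \<Rightarrow> 'a \<Rightarrow> 'a \<Rightarrow> 'e" where
  "coord_at M p \<equiv> snd (chart_at M p)"

abbreviation coord_inv_at :: "('a, 'e) smfd \<Rightarrow> 'a \<Rightarrow> 'e \<Rightarrow> 'a" where
  "coord_inv_at M p \<equiv> inv_into (fst (chart_at M p)) (snd (chart_at M p))"

definition tangent_map ::
  "('a, 'e::real_normed_vector) smfd \<Rightarrow> ('b, 'f::real_normed_vector) smfd \<Rightarrow> ('a \<Rightarrow> 'b) \<Rightarrow> 'a \<Rightarrow> 'e \<Rightarrow> 'f" where
  "tangent_map M N f p =
     frechet_derivative (coord_at N (f p) \<circ> f \<circ> coord_inv_at M p) (at (coord_at M p p))"

definition bundle_map ::
  "('a, 'e::real_normed_vector) smfd \<Rightarrow> ('b, 'f::real_normed_vector) smfd \<Rightarrow> ('a \<Rightarrow> 'b) \<Rightarrow> 'a \<times> 'e \<Rightarrow> 'b \<times> 'f" where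
  "bundle_map M N f = (\<lambda>(p, v). (f p, tangent_map M N f p v))"

definition tangent_chart ::
  "('a, 'e::real_normed_vector) smfd \<Rightarrow> ('a \<Rightarrow> 'e) \<Rightarrow> 'a \<times> 'e \<Rightarrow> 'e \<times> 'e" where
  "tangent_chart M \<phi> =
     (\<lambda>(p, v). (\<phi> p, frechet_derivative (\<phi> \<circ> coord_inv_at M p) (at (coord_at M p p)) v))"

definition tangent_bundle :: "('a, 'e::real_normed_vector) smfd \<Rightarrow> ('a \<times> 'e, 'e \<times> 'e) smfd" where
  "tangent_bundle M = \<lparr>
     mtop = topology_generated_by
       {{x \<in> U \<times> UNIV. tangent_chart M \<phi> x \<in> Y} | U \<phi> Y. (U, \<phi>) \<in> atlas M \<and> open Y},
     atlas = {(U \<times> UNIV, tangent_chart M \<phi>) | U \<phi>. (U, \<phi>) \<in> atlas M} \<rparr>"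

definition submersion ::
  "('a, 'e::real_normed_vector) smfd \<Rightarrow> ('b, 'f::real_normed_vector) smfd \<Rightarrow> ('a \<Rightarrow> 'b) \<Rightarrow> bool" where
  "submersion M N f \<longleftrightarrow> smooth_map M N f \<and> (\<forall>p\<in>points M. surj (tangent_map M N f p))"


section \<open>Lie groupoids and Lie algebroids\<close>

record ('g, 'e, 'q, 'f) groupoid_data =
  arr :: "('g, 'e) smfd"
  obj :: "('q, 'f) smfd"
  src :: "'g \<Rightarrow> 'q"
  tgt :: "'g \<Rightarrow> 'q"
  idn :: "'q \<Rightarrow> 'g"
  gmult :: "'g \<Rightarrow> 'g \<Rightarrow> 'g"
  invs :: "'g \<Rightarrow> 'g"

definition composable :: "('g, 'e, 'q, 'f) groupoid_data \<Rightarrow> ('g \<times> 'g) set" where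
  "composable G = {(g, h). g \<in> points (arr G) \<and> h \<in> points (arr G) \<and> tgt G g = src G h}"

definition lie_groupoid ::
  "('g, 'e::real_normed_vector, 'q, 'f::real_normed_vector) groupoid_data \<Rightarrow> bool" where
  "lie_groupoid G \<longleftrightarrow>
     smooth_manifold (arr G) \<and> smooth_manifold (obj G) \<and>
     submersion (arr G) (obj G) (src G) \<and> submersion (arr G) (obj G) (tgt G) \<and>
     smooth_map (obj G) (arr G) (idn G) \<and> smooth_map (arr G) (arr G) (invs G) \<and>
     smooth_on_subset (prod_smfd (arr G) (arr G)) (composable G) (arr G) (\<lambda>(g, h). gmult G g h) \<and>
     (\<forall>q\<in>points (obj G). src G (idn G q) = q \<and> tgt G (idn G q) = q) \<and>
     (\<forall>(g, h)\<in>composable G. src G (gmult G g h) = src G g \<and> tgt G (gmult G g h) = tgt G h) \<and>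
     (\<forall>g h k. (g, h) \<in> composable G \<and> (h, k) \<in> composable G \<longrightarrow>
        gmult G (gmult G g h) k = gmult G g (gmult G h k)) \<and>
     (\<forall>g\<in>points (arr G).
        gmult G (idn G (src G g)) g = g \<and> gmult G g (idn G (tgt G g)) = g \<and>
        src G (invs G g) = tgt G g \<and> tgt G (invs G g) = src G g \<and>
        gmult G g (invs G g) = idn G (src G g) \<and> gmult G (invs G g) g = idn G (tgt G g))"

definition groupoid_morphism ::
  "('g, 'e::real_normed_vector, 'q, 'f::real_normed_vector) groupoid_data \<Rightarrow>
   ('g2, 'e2::real_normed_vector, 'q2, 'f2::real_normed_vector) groupoid_data \<Rightarrow>
   ('g \<Rightarrow> 'g2) \<Rightarrow> ('q \<Rightarrow> 'q2) \<Rightarrow> bool" where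
  "groupoid_morphism G G' \<Psi> \<psi> \<longleftrightarrow>
     smooth_map (arr G) (arr G') \<Psi> \<and> smooth_map (obj G) (obj G') \<psi> \<and>
     (\<forall>g\<in>points (arr G). src G' (\<Psi> g) = \<psi> (src G g) \<and> tgt G' (\<Psi> g) = \<psi> (tgt G g)) \<and>
     (\<forall>q\<in>points (obj G). \<Psi> (idn G q) = idn G' (\<psi> q)) \<and>
     (\<forall>(g, h)\<in>composable G. \<Psi> (gmult G g h) = gmult G' (\<Psi> g) (\<Psi> h))"

definition groupoid_iso ::
  "('g, 'e::real_normed_vector, 'q, 'f::real_normed_vector) groupoid_data \<Rightarrow>
   ('g2, 'e2::real_normed_vector, 'q2, 'f2::real_normed_vector) groupoid_data \<Rightarrow>
   ('g \<Rightarrow> 'g2) \<Rightarrow> ('q \<Rightarrow> 'q2) \<Rightarrow> bool" where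
  "groupoid_iso G G' \<Psi> \<psi> \<longleftrightarrow> groupoid_morphism G G' \<Psi> \<psi> \<and>
     (\<exists>\<Psi>' \<psi>'. groupoid_morphism G' G \<Psi>' \<psi>' \<and>
        (\<forall>g\<in>points (arr G). \<Psi>' (\<Psi> g) = g) \<and> (\<forall>g\<in>points (arr G'). \<Psi> (\<Psi>' g) = g) \<and>
        (\<forall>q\<in>points (obj G). \<psi>' (\<psi> q) = q) \<and> (\<forall>q\<in>points (obj G'). \<psi> (\<psi>' q) = q))"

definition algebroid_fibre ::
  "('g, 'e::real_normed_vector, 'q, 'f::real_normed_vector) groupoid_data \<Rightarrow> 'q \<Rightarrow> 'e set" where
  "algebroid_fibre G q = {v. tangent_map (arr G) (obj G) (src G) (idn G q) v = 0}"

text \<open>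
  The total space of the Lie algebroid as a subset of the tangent bundle of the arrows. For a Lie
  groupoid morphism \<open>(\<Psi>, \<psi>)\<close> the induced map of Lie algebroids is the restriction of \<open>bundle_map\<close>
  of \<open>\<Psi>\<close> to it.
\<close>

definition algebroid ::
  "('g, 'e::real_normed_vector, 'q, 'f::real_normed_vector) groupoid_data \<Rightarrow> ('g \<times> 'e) set" where
  "algebroid G = {(idn G q, v) | q v. q \<in> points (obj G) \<and> v \<in> algebroid_fibre G q}"


section \<open>Generalized discretization maps\<close>

definition zero_section ::
  "('g, 'e::real_normed_vector, 'q, 'f::real_normed_vector) groupoid_data \<Rightarrow> 'q \<Rightarrow> 'g \<times> 'e" where
  "zero_section G q = (idn G q, 0)"

text \<open>
  The fibre \<open>A\<^sub>qG\<close> is a linear subspace of the model space \<open>'e\<close>, and so is its tangent space at zero.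
\<close>

definition vertical_lift :: "'e::real_normed_vector \<Rightarrow> 'e" where
  "vertical_lift v = vector_derivative (\<lambda>t::real. t *\<^sub>R v) (at 0)"

text \<open>
  The tangent map at zero of the restriction of \<open>R\<close> to the vector space \<open>A\<^sub>qG\<close>. The derivative is
  taken within \<open>A\<^sub>qG\<close>, hence is determined (and only meaningful) on vectors of \<open>A\<^sub>qG\<close>.
\<close>

definition fibre_tangent_map ::
  "('g, 'e::real_normed_vector, 'q, 'f::real_normed_vector) groupoid_data \<Rightarrow>
   ('g \<times> 'e \<Rightarrow> 'g) \<Rightarrow> 'q \<Rightarrow> 'e \<Rightarrow> 'e" where
  "fibre_tangent_map G R q =
     frechet_derivative (\<lambda>w. coord_at (arr G) (R (zero_section G q)) (R (idn G q, w)))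
       (at 0 within algebroid_fibre G q)"

definition generalized_discretization_map ::
  "('g, 'e::real_normed_vector, 'q, 'f::real_normed_vector) groupoid_data \<Rightarrow> ('g \<times> 'e \<Rightarrow> 'g) \<Rightarrow> bool" where
  "generalized_discretization_map G R \<longleftrightarrow>
     smooth_on_subset (tangent_bundle (arr G)) (algebroid G) (arr G) R \<and>
     (\<forall>q\<in>points (obj G). R (zero_section G q) = idn G q) \<and>
     (\<forall>q\<in>points (obj G). \<forall>v\<in>algebroid_fibre G q.
        fibre_tangent_map G R q (vertical_lift v) =
          v + (tangent_map (obj G) (arr G) (idn G) q \<circ>
               tangent_map (arr G) (obj G) (src G) (idn G q) \<circ>
               fibre_tangent_map G R q) (vertical_lift v))"


section \<open>Actions and quotients\<close>

definition lie_group :: "'h monoid \<Rightarrow> ('h, 'k::real_normed_vector) smfd \<Rightarrow> bool" where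
  "lie_group H MH \<longleftrightarrow> group H \<and> smooth_manifold MH \<and> points MH = carrier H \<and>
     smooth_map (prod_smfd MH MH) MH (\<lambda>(h, k). h \<otimes>\<^bsub>H\<^esub> k) \<and>
     smooth_map MH MH (\<lambda>h. inv\<^bsub>H\<^esub> h)"

definition smooth_action ::
  "'h monoid \<Rightarrow> ('h, 'k::real_normed_vector) smfd \<Rightarrow> ('a, 'e::real_normed_vector) smfd \<Rightarrow>
   ('h \<Rightarrow> 'a \<Rightarrow> 'a) \<Rightarrow> bool" where
  "smooth_action H MH M \<Phi> \<longleftrightarrow>
     smooth_map (prod_smfd MH M) M (\<lambda>(h, x). \<Phi> h x) \<and>
     (\<forall>x\<in>points M. \<Phi> \<one>\<^bsub>H\<^esub> x = x) \<and>
     (\<forall>h\<in>carrier H. \<forall>k\<in>carrier H. \<forall>x\<in>points M. \<Phi> (h \<otimes>\<^bsub>H\<^esub> k) x = \<Phi> h (\<Phi> k x))"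

definition free_action :: "'h monoid \<Rightarrow> ('a, 'e) smfd \<Rightarrow> ('h \<Rightarrow> 'a \<Rightarrow> 'a) \<Rightarrow> bool" where
  "free_action H M \<Phi> \<longleftrightarrow> (\<forall>h\<in>carrier H. \<forall>x\<in>points M. \<Phi> h x = x \<longrightarrow> h = \<one>\<^bsub>H\<^esub>)"

definition proper_action ::
  "('h, 'k) smfd \<Rightarrow> ('a, 'e) smfd \<Rightarrow> ('h \<Rightarrow> 'a \<Rightarrow> 'a) \<Rightarrow> bool" where
  "proper_action MH M \<Phi> \<longleftrightarrow>
     proper_map (prod_topology (mtop MH) (mtop M)) (prod_topology (mtop M) (mtop M))
       (\<lambda>(h, x). (\<Phi> h x, x))"

text \<open>
  As usual, the action on the groupoid is called free and proper when the action \<open>\<phi>\<close> on the base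
  is; the action \<open>\<Phi>\<close> on the arrows then is as well.
\<close>

definition free_proper_groupoid_action ::
  "'h monoid \<Rightarrow> ('h, 'k::real_normed_vector) smfd \<Rightarrow>
   ('g, 'e::real_normed_vector, 'q, 'f::real_normed_vector) groupoid_data \<Rightarrow>
   ('h \<Rightarrow> 'g \<Rightarrow> 'g) \<Rightarrow> ('h \<Rightarrow> 'q \<Rightarrow> 'q) \<Rightarrow> bool" where
  "free_proper_groupoid_action H MH G \<Phi> \<phi> \<longleftrightarrow>
     smooth_action H MH (arr G) \<Phi> \<and> smooth_action H MH (obj G) \<phi> \<and>
     (\<forall>h\<in>carrier H. groupoid_iso G G (\<Phi> h) (\<phi> h)) \<and>
     free_action H (obj G) \<phi> \<and> proper_action MH (obj G) \<phi>"

text \<open>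
  \<open>orbit_proj H \<Phi>\<close> is the canonical projection to the orbit space, \<open>orbit_space H \<Phi> X\<close> is \<open>X/H\<close>.
\<close>

definition orbit_proj :: "'h monoid \<Rightarrow> ('h \<Rightarrow> 'a \<Rightarrow> 'a) \<Rightarrow> 'a \<Rightarrow> 'a set" where
  "orbit_proj H \<Phi> x = (\<lambda>h. \<Phi> h x) ` carrier H"

definition orbit_space :: "'h monoid \<Rightarrow> ('h \<Rightarrow> 'a \<Rightarrow> 'a) \<Rightarrow> 'a set \<Rightarrow> 'a set set" where
  "orbit_space H \<Phi> X = orbit_proj H \<Phi> ` X"

text \<open>
  The smooth structure of a quotient manifold is, up to equivalence of atlases, the unique one for
  which the canonical projection is a submersion.
\<close>

definition quotient_manifold ::
  "'h monoid \<Rightarrow> ('h \<Rightarrow> 'a \<Rightarrow> 'a) \<Rightarrow> ('a, 'e::real_normed_vector) smfd \<Rightarrow>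
   ('a set, 'e2::real_normed_vector) smfd \<Rightarrow> bool" where
  "quotient_manifold H \<Phi> M Mhat \<longleftrightarrow> smooth_manifold Mhat \<and>
     points Mhat = orbit_space H \<Phi> (points M) \<and> submersion M Mhat (orbit_proj H \<Phi>)"

text \<open>
  That the projections form a groupoid morphism says precisely that the structural maps of the
  quotient are induced from those of \<open>G\<close>.
\<close>

definition quotient_lie_groupoid ::
  "'h monoid \<Rightarrow> ('h \<Rightarrow> 'g \<Rightarrow> 'g) \<Rightarrow> ('h \<Rightarrow> 'q \<Rightarrow> 'q) \<Rightarrow>
   ('g, 'e::real_normed_vector, 'q, 'f::real_normed_vector) groupoid_data \<Rightarrow>
   ('g set, 'e2::real_normed_vector, 'q set, 'f2::real_normed_vector) groupoid_data \<Rightarrow> bool" where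
  "quotient_lie_groupoid H \<Phi> \<phi> G Ghat \<longleftrightarrow> lie_groupoid Ghat \<and>
     quotient_manifold H \<Phi> (arr G) (arr Ghat) \<and> quotient_manifold H \<phi> (obj G) (obj Ghat) \<and>
     groupoid_morphism G Ghat (orbit_proj H \<Phi>) (orbit_proj H \<phi>)"

definition algebroid_action ::
  "('g, 'e::real_normed_vector, 'q, 'f::real_normed_vector) groupoid_data \<Rightarrow>
   ('h \<Rightarrow> 'g \<Rightarrow> 'g) \<Rightarrow> 'h \<Rightarrow> 'g \<times> 'e \<Rightarrow> 'g \<times> 'e" where
  "algebroid_action G \<Phi> h = bundle_map (arr G) (arr G) (\<Phi> h)"

text \<open>
  The identification of \<open>AG/H\<close> with the Lie algebroid of the quotient groupoid, under which the
  canonical projection of \<open>AG\<close> corresponds to the Lie algebroid morphism induced by the canonical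
  projection of \<open>G\<close>. These conditions determine \<open>\<iota>\<close> on \<open>AG/H\<close>.
\<close>

definition quotient_algebroid_identification ::
  "'h monoid \<Rightarrow> ('h \<Rightarrow> 'g \<Rightarrow> 'g) \<Rightarrow>
   ('g, 'e::real_normed_vector, 'q, 'f::real_normed_vector) groupoid_data \<Rightarrow>
   ('g set, 'e2::real_normed_vector, 'q set, 'f2::real_normed_vector) groupoid_data \<Rightarrow>
   (('g \<times> 'e) set \<Rightarrow> 'g set \<times> 'e2) \<Rightarrow> bool" where
  "quotient_algebroid_identification H \<Phi> G Ghat \<iota> \<longleftrightarrow>
     bij_betw \<iota> (orbit_space H (algebroid_action G \<Phi>) (algebroid G)) (algebroid Ghat) \<and>
     (\<forall>w\<in>algebroid G. \<iota> (orbit_proj H (algebroid_action G \<Phi>) w) =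
        bundle_map (arr G) (arr Ghat) (orbit_proj H \<Phi>) w)"

end

theory Submission
  imports Defs
begin

text \<open>
  Write \<open>\<pi> : G \<rightarrow> G/H\<close> for the projection of the arrows and \<open>A\<pi>\<close> for its restriction to the Lie
  algebroid. By construction \<open>Rhat \<circ> A\<pi> = \<pi> \<circ> R\<close>, and the identification of \<open>AG/H\<close> with the
  algebroid of \<open>G/H\<close> makes \<open>A\<pi>\<close> surjective: every vector \<open>u\<close> of the fibre over a point of \<open>Q/H\<close> is
  \<open>T\<pi> w\<close> for some \<open>w\<close> in the fibre over a suitable representative \<open>q\<close>, which may depend on \<open>u\<close>.

  On the zero section, \<open>Rhat 0 = Rhat (A\<pi> 0) = \<pi> (R 0) = \<pi> (\<epsilon> q)\<close>, which is the identity arrow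
  of the quotient. For the derivative condition, differentiate \<open>Rhat (t u) = \<pi> (R (t w))\<close> at
  \<open>t = 0\<close>; the fibrewise derivatives then satisfy \<open>TRhat u = T\<pi> (TR w)\<close>
  (\<open>fibre_derivative_naturality\<close>). Applying \<open>T\<pi>\<close> to the condition
  \<open>TR w = w + T\<epsilon> (T\<alpha> (TR w))\<close> and moving \<open>T\<pi>\<close> past \<open>T\<epsilon>\<close> and \<open>T\<alpha>\<close>, which is the chain rule
  (\<open>tangent_map_chain\<close>) for the groupoid morphism \<open>\<pi>\<close>, gives the condition for \<open>u\<close>.

  One analytic point needs care. The derivative of \<open>Rhat\<close> is taken within the fibre, and it is
  determined by the curves \<open>t \<mapsto> t u\<close> only once it is known to exist. Existence comes from a local
  smooth extension of \<open>Rhat\<close> to the tangent bundle (\<open>fibre_differentiable\<close>).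
\<close>

section \<open>Charts and tangent maps\<close>

lemma chart_at_props:
  assumes "smooth_manifold M" "p \<in> points M"
  shows chart_at_in_atlas: "chart_at M p \<in> atlas M"
    and chart_at_contains: "p \<in> fst (chart_at M p)"
    and chart_at_openin: "openin (mtop M) (fst (chart_at M p))"
    and chart_at_open_image: "open (coord_at M p ` fst (chart_at M p))"
    and chart_at_inj: "inj_on (coord_at M p) (fst (chart_at M p))"
    and chart_at_homeomorphic: "homeomorphic_map (subtopology (mtop M) (fst (chart_at M p)))
          (top_of_set (coord_at M p ` fst (chart_at M p))) (coord_at M p)"
proof -
  have "p \<in> (\<Union>(U, \<phi>)\<in>atlas M. U)"
    using assms unfolding smooth_manifold_def by blast
  then have "\<exists>c. c \<in> atlas M \<and> p \<in> fst c" by auto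
  then have *: "chart_at M p \<in> atlas M \<and> p \<in> fst (chart_at M p)"
    unfolding chart_at_def by (rule someI_ex)
  then show "chart_at M p \<in> atlas M" "p \<in> fst (chart_at M p)" by auto
  have "\<forall>(U, \<phi>)\<in>atlas M. openin (mtop M) U \<and> open (\<phi> ` U) \<and>
      homeomorphic_map (subtopology (mtop M) U) (top_of_set (\<phi> ` U)) \<phi>"
    using assms(1) unfolding smooth_manifold_def by blast
  with * have **: "openin (mtop M) (fst (chart_at M p))"
    "open (coord_at M p ` fst (chart_at M p))"
    "homeomorphic_map (subtopology (mtop M) (fst (chart_at M p)))
       (top_of_set (coord_at M p ` fst (chart_at M p))) (coord_at M p)"
    by (auto simp: case_prod_beta)
  show "openin (mtop M) (fst (chart_at M p))" "open (coord_at M p ` fst (chart_at M p))"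
    "homeomorphic_map (subtopology (mtop M) (fst (chart_at M p)))
       (top_of_set (coord_at M p ` fst (chart_at M p))) (coord_at M p)"
    by (fact **)+
  show "inj_on (coord_at M p) (fst (chart_at M p))"
    using homeomorphic_imp_injective_map[OF **(3)] openin_subset[OF **(1)]
    by (simp add: Int_absorb1)
qed

lemma coord_inv_at_coord_at [simp]:
  assumes "smooth_manifold M" "p \<in> points M" "x \<in> fst (chart_at M p)"
  shows "coord_inv_at M p (coord_at M p x) = x"
  using chart_at_inj[OF assms(1,2)] assms(3) by simp

lemma eventually_coord_inv_at_in:
  assumes M: "smooth_manifold M" and X: "openin (mtop M) X" "p \<in> X"
  shows "\<forall>\<^sub>F x in nhds (coord_at M p p). coord_inv_at M p x \<in> X"
proof -
  have p: "p \<in> points M" using X openin_subset by blast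
  let ?U = "fst (chart_at M p)" and ?\<phi> = "coord_at M p"
  have "openin (subtopology (mtop M) ?U) (?U \<inter> X)"
    using X(1) openin_subtopology_Int2 by blast
  then have "openin (top_of_set (?\<phi> ` ?U)) (?\<phi> ` (?U \<inter> X))"
    using homeomorphic_imp_open_map[OF chart_at_homeomorphic[OF M p]] open_map_def by blast
  then have op: "open (?\<phi> ` (?U \<inter> X))"
    using chart_at_open_image[OF M p] openin_open_trans by blast
  moreover have "?\<phi> p \<in> ?\<phi> ` (?U \<inter> X)"
    using chart_at_contains[OF M p] X by blast
  ultimately have "\<forall>\<^sub>F x in nhds (?\<phi> p). x \<in> ?\<phi> ` (?U \<inter> X)"
    by (rule eventually_nhds_in_open)
  then show ?thesis
    by eventually_elim (use M p in auto)
qed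

lemma Cinf_on_differentiable: "Cinf_on U f \<Longrightarrow> x \<in> U \<Longrightarrow> f differentiable (at x)"
  unfolding Cinf_on_def using Ck_on.simps(2)[of 0 U f] by blast

lemma smooth_on_open_local_differentiable:
  assumes "smooth_on_open M W N f" "(U, \<phi>) \<in> atlas M" "(V, \<psi>) \<in> atlas N"
    and "x \<in> U" "x \<in> W" "f x \<in> V"
  shows "(\<psi> \<circ> f \<circ> inv_into U \<phi>) differentiable (at (\<phi> x))"
proof (rule Cinf_on_differentiable)
  show "Cinf_on (\<phi> ` {p \<in> U \<inter> W. f p \<in> V}) (\<psi> \<circ> f \<circ> inv_into U \<phi>)"
    using assms(1-3) unfolding smooth_on_open_def by blast
qed (use assms in auto)

lemma smooth_on_open_continuous_map:
  "smooth_on_open M W N f \<Longrightarrow> continuous_map (subtopology (mtop M) W) (mtop N) f"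
  unfolding smooth_on_open_def by blast

lemma smooth_on_open_openin: "smooth_on_open M W N f \<Longrightarrow> openin (mtop M) W"
  unfolding smooth_on_open_def by blast

lemma smooth_map_in_points: "smooth_map M N f \<Longrightarrow> p \<in> points M \<Longrightarrow> f p \<in> points N"
  unfolding smooth_map_def
  by (metis continuous_map_image_subset_topspace image_subset_iff smooth_on_open_continuous_map
      subtopology_topspace)

lemma tangent_map_has_derivative:
  assumes M: "smooth_manifold M" and N: "smooth_manifold N" and f: "smooth_map M N f"
    and p: "p \<in> points M"
  shows "((coord_at N (f p) \<circ> f \<circ> coord_inv_at M p) has_derivative tangent_map M N f p)
           (at (coord_at M p p))"
proof -
  have fp: "f p \<in> points N" by (rule smooth_map_in_points[OF f p])
  have "(coord_at N (f p) \<circ> f \<circ> coord_inv_at M p) differentiable (at (coord_at M p p))"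
    using f unfolding smooth_map_def
    by (rule smooth_on_open_local_differentiable[where V = "fst (chart_at N (f p))"])
      (use M N p fp chart_at_in_atlas chart_at_contains in auto)
  then show ?thesis
    unfolding tangent_map_def by (simp add: frechet_derivative_works)
qed

lemma linear_tangent_map:
  assumes "smooth_manifold M" "smooth_manifold N" "smooth_map M N f" "p \<in> points M"
  shows "linear (tangent_map M N f p)"
  using has_derivative_linear[OF tangent_map_has_derivative[OF assms]] .

text \<open>
  The chain rule, for a composite \<open>k\<close> that is given only up to equality on the points of \<open>M\<close>: the
  structural identities of a groupoid hold on the manifold and say nothing outside it.
\<close>

lemma tangent_map_chain:
  assumes M: "smooth_manifold M" and N: "smooth_manifold N" and P: "smooth_manifold P"
    and f: "smooth_map M N f" and g: "smooth_map N P g"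
    and k: "\<And>x. x \<in> points M \<Longrightarrow> k x = g (f x)" and p: "p \<in> points M"
  shows "tangent_map M P k p v = tangent_map N P g (f p) (tangent_map M N f p v)"
proof -
  let ?F = "coord_at N (f p) \<circ> f \<circ> coord_inv_at M p"
  let ?Gm = "coord_at P (g (f p)) \<circ> g \<circ> coord_inv_at N (f p)"
  let ?V = "fst (chart_at N (f p))"
  have fp: "f p \<in> points N" by (rule smooth_map_in_points[OF f p])
  have inv: "coord_inv_at M p (coord_at M p p) = p"
    using chart_at_contains[OF M p] M p by simp
  have "(?Gm has_derivative tangent_map N P g (f p)) (at (?F (coord_at M p p)))"
    using tangent_map_has_derivative[OF N P g fp] inv by simp
  with tangent_map_has_derivative[OF M N f p]
  have D: "(?Gm \<circ> ?F has_derivative tangent_map N P g (f p) \<circ> tangent_map M N f p)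
      (at (coord_at M p p))"
    by (rule diff_chain_at)
  have "continuous_map (mtop M) (mtop N) f"
    using smooth_on_open_continuous_map f unfolding smooth_map_def by fastforce
  then have "openin (mtop M) {x \<in> points M. f x \<in> ?V}"
    using chart_at_openin[OF N fp] openin_continuous_map_preimage by blast
  then have ev: "\<forall>\<^sub>F x in nhds (coord_at M p p). coord_inv_at M p x \<in> {x \<in> points M. f x \<in> ?V}"
    using p chart_at_contains[OF N fp] by (intro eventually_coord_inv_at_in[OF M]) auto
  have eq: "\<forall>\<^sub>F x in nhds (coord_at M p p).
      (?Gm \<circ> ?F) x = (coord_at P (k p) \<circ> k \<circ> coord_inv_at M p) x"
    using ev by eventually_elim (use N fp k p in auto)
  have "\<forall>\<^sub>F x in at (coord_at M p p).
      (?Gm \<circ> ?F) x = (coord_at P (k p) \<circ> k \<circ> coord_inv_at M p) x"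
    using eq unfolding eventually_at_filter by eventually_elim blast
  from has_derivative_transform_eventually[OF D this eventually_nhds_x_imp_x[OF eq] UNIV_I]
  have "((coord_at P (k p) \<circ> k \<circ> coord_inv_at M p) has_derivative
      tangent_map N P g (f p) \<circ> tangent_map M N f p) (at (coord_at M p p))" .
  then show ?thesis
    unfolding tangent_map_def[of M P k] by (metis comp_apply frechet_derivative_at)
qed


section \<open>Smooth maps along a fibre of the tangent bundle\<close>

lemma transition_differentiable:
  assumes M: "smooth_manifold M" and U: "(U, \<phi>) \<in> atlas M" and p: "p \<in> U"
  shows "(\<phi> \<circ> coord_inv_at M p) differentiable (at (coord_at M p p))"
proof -
  have pM: "p \<in> points M"
    using M U p unfolding smooth_manifold_def by blast
  have "\<forall>(U, \<phi>)\<in>atlas M. \<forall>(V, \<psi>)\<in>atlas M. Cinf_on (\<phi> ` (U \<inter> V)) (\<psi> \<circ> inv_into U \<phi>)"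
    using M unfolding smooth_manifold_def by blast
  with chart_at_in_atlas[OF M pM] U
  have "Cinf_on (coord_at M p ` (fst (chart_at M p) \<inter> U)) (\<phi> \<circ> coord_inv_at M p)"
    by (fastforce simp: case_prod_beta)
  then show ?thesis
    by (rule Cinf_on_differentiable) (use p chart_at_contains[OF M pM] in auto)
qed

lemma continuous_map_fibre_inclusion:
  fixes M :: "('a, 'e::real_normed_vector) smfd"
  assumes M: "smooth_manifold M" and p: "p \<in> points M"
  shows "continuous_map euclidean (mtop (tangent_bundle M)) (\<lambda>w. (p, w))"
proof -
  let ?B = "{{x \<in> U \<times> UNIV. tangent_chart M \<phi> x \<in> Y} | U \<phi> Y. (U, \<phi>) \<in> atlas M \<and> open Y}"
  have "continuous_map euclidean (topology_generated_by ?B) (\<lambda>w::'e. (p, w))"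
  proof (rule continuous_on_generated_topo)
    fix B assume "B \<in> ?B"
    then obtain U \<phi> Y where B: "B = {x \<in> U \<times> UNIV. tangent_chart M \<phi> x \<in> Y}"
      and U: "(U, \<phi>) \<in> atlas M" and Y: "open Y" by blast
    show "openin euclidean ((\<lambda>w::'e. (p, w)) -` B \<inter> topspace euclidean)"
    proof (cases "p \<in> U")
      case True
      let ?D = "frechet_derivative (\<phi> \<circ> coord_inv_at M p) (at (coord_at M p p))"
      have "bounded_linear ?D"
        using transition_differentiable[OF M U True]
        by (simp add: frechet_derivative_works has_derivative_bounded_linear)
      then have "continuous_on UNIV (\<lambda>w. (\<phi> p, ?D w))"
        by (intro continuous_intros linear_continuous_on)
      then have "open ((\<lambda>w. (\<phi> p, ?D w)) -` Y)"
        using Y open_vimage by blast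
      moreover have "(\<lambda>w. (p, w)) -` B = (\<lambda>w. (\<phi> p, ?D w)) -` Y"
        using True by (auto simp: B tangent_chart_def)
      ultimately show ?thesis by simp
    qed (auto simp: B)
  next
    let ?U = "fst (chart_at M p)" and ?\<phi> = "coord_at M p"
    have "{x \<in> ?U \<times> UNIV. tangent_chart M ?\<phi> x \<in> UNIV} \<in> ?B"
      using chart_at_in_atlas[OF M p] open_UNIV
      by (intro CollectI exI[of _ ?U] exI[of _ ?\<phi>] exI[of _ UNIV]) simp
    moreover have "(p, w) \<in> {x \<in> ?U \<times> UNIV. tangent_chart M ?\<phi> x \<in> UNIV}" for w
      using chart_at_contains[OF M p] by simp
    ultimately show "(\<lambda>w::'e. (p, w)) ` topspace euclidean \<subseteq> \<Union> ?B"
      by (intro subsetI) (elim imageE, blast)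
  qed
  then show ?thesis by (simp add: tangent_bundle_def)
qed

text \<open>
  In the chart of the tangent bundle that belongs to the chart chosen at \<open>p\<close>, the fibre over \<open>p\<close> is
  an affine slice: the transition from the chosen chart to itself is the identity near \<open>p\<close>, so the
  coordinates of \<open>(p, w)\<close> are those of \<open>p\<close> together with \<open>w\<close> itself.
\<close>

lemma tangent_chart_fibre:
  assumes M: "smooth_manifold M" and p: "p \<in> points M"
  shows "tangent_chart M (coord_at M p) (p, w) = (coord_at M p p, w)"
proof -
  have "frechet_derivative (coord_at M p \<circ> coord_inv_at M p) (at (coord_at M p p)) =
      frechet_derivative (\<lambda>x. x) (at (coord_at M p p))"
    by (rule frechet_derivative_transform_within_open[symmetric,
          where X = "coord_at M p ` fst (chart_at M p)"])
      (use chart_at_contains[OF M p] chart_at_open_image[OF M p]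
        in \<open>auto simp: f_inv_into_f\<close>)
  then show ?thesis by (simp add: tangent_chart_def)
qed

lemma inv_into_tangent_chart_fibre:
  assumes M: "smooth_manifold M" and p: "p \<in> points M"
  shows "inv_into (fst (chart_at M p) \<times> UNIV) (tangent_chart M (coord_at M p))
           (coord_at M p p, w) = (p, w)"
proof -
  let ?S = "fst (chart_at M p) \<times> UNIV" and ?c = "tangent_chart M (coord_at M p)"
  have mem: "(coord_at M p p, w) \<in> ?c ` ?S"
    using tangent_chart_fibre[OF M p] chart_at_contains[OF M p]
    by (metis SigmaI UNIV_I imageI)
  obtain x v where x: "inv_into ?S ?c (coord_at M p p, w) = (x, v)" by fastforce
  have "x \<in> fst (chart_at M p)" and c: "?c (x, v) = (coord_at M p p, w)"
    using inv_into_into[OF mem] f_inv_into_f[OF mem] x by auto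
  moreover from c have "coord_at M p x = coord_at M p p"
    by (simp add: tangent_chart_def)
  ultimately have "x = p"
    using chart_at_inj[OF M p] chart_at_contains[OF M p] by (auto dest: inj_onD)
  with c show ?thesis using x tangent_chart_fibre[OF M p] by simp
qed

lemma smooth_on_subset_eventually_in:
  assumes M: "smooth_manifold M" and f: "smooth_on_subset (tangent_bundle M) S N f"
    and p: "p \<in> points M" and S: "(p, 0) \<in> S" and V: "openin (mtop N) V" "f (p, 0) \<in> V"
  shows "\<forall>\<^sub>F w in nhds 0. (p, w) \<in> S \<longrightarrow> f (p, w) \<in> V"
proof -
  obtain W F where W: "(p, 0) \<in> W" "smooth_on_open (tangent_bundle M) W N F"
    and F: "\<forall>x\<in>W \<inter> S. F x = f x"
    using f S unfolding smooth_on_subset_def by blast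
  let ?X = "{x \<in> topspace (subtopology (mtop (tangent_bundle M)) W). F x \<in> V}"
  have "openin (subtopology (mtop (tangent_bundle M)) W) ?X"
    using openin_continuous_map_preimage smooth_on_open_continuous_map[OF W(2)] V(1) by blast
  then have "openin (mtop (tangent_bundle M)) ?X"
    using smooth_on_open_openin[OF W(2)] openin_trans_full by blast
  then have "openin euclidean {w \<in> topspace euclidean. (p, w) \<in> ?X}"
    by (rule openin_continuous_map_preimage[OF continuous_map_fibre_inclusion[OF M p]])
  then have "open {w. (p, w) \<in> ?X}" by simp
  moreover have "(p, 0) \<in> points (tangent_bundle M)"
    using W(1) openin_subset[OF smooth_on_open_openin[OF W(2)]] by blast
  then have "0 \<in> {w. (p, w) \<in> ?X}" using F W(1) S V(2) by auto
  ultimately have "\<forall>\<^sub>F w in nhds 0. w \<in> {w. (p, w) \<in> ?X}"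
    by (rule eventually_nhds_in_open)
  then show ?thesis by eventually_elim (use F in auto)
qed

text \<open>
  A local smooth extension of \<open>f\<close> is differentiable in coordinates at \<open>(p, 0)\<close>, and the fibre enters
  these coordinates as the affine slice above.
\<close>

lemma fibre_differentiable:
  assumes M: "smooth_manifold M" and N: "smooth_manifold N"
    and f: "smooth_on_subset (tangent_bundle M) S N f"
    and p: "p \<in> points M" and S: "(p, 0) \<in> S" and fp: "f (p, 0) \<in> points N"
  shows "(\<lambda>w. coord_at N (f (p, 0)) (f (p, w))) differentiable (at 0 within {w. (p, w) \<in> S})"
proof -
  obtain W F where W: "(p, 0) \<in> W" "smooth_on_open (tangent_bundle M) W N F"
    and F: "\<forall>x\<in>W \<inter> S. F x = f x"
    using f S unfolding smooth_on_subset_def by blast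
  let ?U = "fst (chart_at M p)" and ?\<psi> = "coord_at N (f (p, 0))"
  let ?c = "tangent_chart M (coord_at M p)"
  let ?L = "?\<psi> \<circ> F \<circ> inv_into (?U \<times> UNIV) ?c"
  have F0: "F (p, 0) = f (p, 0)" using F W(1) S by blast
  have "(?U \<times> UNIV, ?c) \<in> atlas (tangent_bundle M)"
    using chart_at_in_atlas[OF M p] unfolding tangent_bundle_def smfd.simps
    by (intro CollectI exI[of _ ?U] exI[of _ "coord_at M p"]) simp
  moreover have "(fst (chart_at N (f (p, 0))), ?\<psi>) \<in> atlas N"
    using chart_at_in_atlas[OF N fp] by simp
  ultimately have "?L differentiable (at (?c (p, 0)))"
    using W chart_at_contains[OF M p] chart_at_contains[OF N fp] F0
    by (intro smooth_on_open_local_differentiable[OF W(2)]) auto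
  then obtain D where D: "(?L has_derivative D) (at (coord_at M p p, 0))"
    unfolding tangent_chart_fibre[OF M p] differentiable_def by blast
  have "((\<lambda>w. (coord_at M p p, w)) has_derivative (\<lambda>w. (0, w))) (at 0)"
    by (auto intro!: derivative_eq_intros)
  from diff_chain_at[OF this D]
  have "((\<lambda>w. ?\<psi> (F (p, w))) has_derivative D \<circ> (\<lambda>w. (0, w))) (at 0)"
    by (simp add: o_def inv_into_tangent_chart_fibre[OF M p])
  then have D': "((\<lambda>w. ?\<psi> (F (p, w))) has_derivative D \<circ> (\<lambda>w. (0, w)))
      (at 0 within {w. (p, w) \<in> S})"
    by (rule has_derivative_at_withinI)
  have "open {w. (p, w) \<in> W}"
    using openin_continuous_map_preimage[OF continuous_map_fibre_inclusion[OF M p]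
        smooth_on_open_openin[OF W(2)]] by simp
  then have "\<forall>\<^sub>F w in nhds 0. w \<in> {w. (p, w) \<in> W}"
    using W(1) by (intro eventually_nhds_in_open) auto
  then have "\<forall>\<^sub>F w in at 0 within {w. (p, w) \<in> S}. ?\<psi> (F (p, w)) = ?\<psi> (f (p, w))"
    unfolding eventually_at_filter by eventually_elim (use F in auto)
  from has_derivative_transform_eventually[OF D' this]
  have "((\<lambda>w. ?\<psi> (f (p, w))) has_derivative D \<circ> (\<lambda>w. (0, w))) (at 0 within {w. (p, w) \<in> S})"
    using F0 S by simp
  then show ?thesis by (rule differentiableI)
qed

text \<open>
  The derivative within a subspace is determined on the subspace because it can be computed along
  lines through the origin.
\<close>

lemma has_derivative_within_subspace_line:
  fixes f :: "'a::real_normed_vector \<Rightarrow> 'b::real_normed_vector"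
  assumes f: "(f has_derivative D) (at 0 within S)" and S: "subspace S" and u: "u \<in> S"
  shows "((\<lambda>t. f (t *\<^sub>R u)) has_vector_derivative D u) (at 0)"
proof -
  have "range (\<lambda>t::real. t *\<^sub>R u) \<subseteq> S"
    using subspace_scale[OF S u] by blast
  then have "(f has_derivative D) (at ((0::real) *\<^sub>R u) within range (\<lambda>t::real. t *\<^sub>R u))"
    using has_derivative_subset[OF f] by simp
  moreover have "((\<lambda>t::real. t *\<^sub>R u) has_derivative (\<lambda>t. t *\<^sub>R u)) (at 0)"
    by (auto intro!: derivative_eq_intros)
  ultimately have "(f \<circ> (\<lambda>t. t *\<^sub>R u) has_derivative D \<circ> (\<lambda>t. t *\<^sub>R u)) (at 0)"
    by (intro diff_chain_within) auto
  then show ?thesis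
    using has_derivative_linear[OF f] by (simp add: has_vector_derivative_def o_def linear_cmul)
qed


section \<open>The Lie algebroid and fibrewise derivatives\<close>

lemma lie_groupoid_props:
  assumes "lie_groupoid G"
  shows lie_groupoid_arr: "smooth_manifold (arr G)"
    and lie_groupoid_obj: "smooth_manifold (obj G)"
    and lie_groupoid_src: "smooth_map (arr G) (obj G) (src G)"
    and lie_groupoid_idn: "smooth_map (obj G) (arr G) (idn G)"
    and lie_groupoid_src_idn: "\<And>q. q \<in> points (obj G) \<Longrightarrow> src G (idn G q) = q"
proof -
  note * = assms[unfolded lie_groupoid_def submersion_def]
  show "smooth_manifold (arr G)" using * by (elim conjE)
  show "smooth_manifold (obj G)" using * by (elim conjE)
  show "smooth_map (arr G) (obj G) (src G)" using * by (elim conjE)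
  show "smooth_map (obj G) (arr G) (idn G)" using * by (elim conjE)
  have "\<forall>q\<in>points (obj G). src G (idn G q) = q \<and> tgt G (idn G q) = q"
    using * by (elim conjE)
  then show "src G (idn G q) = q" if "q \<in> points (obj G)" for q
    using that by simp
qed

lemma idn_in_points: "lie_groupoid G \<Longrightarrow> q \<in> points (obj G) \<Longrightarrow> idn G q \<in> points (arr G)"
  by (rule smooth_map_in_points[OF lie_groupoid_idn])

lemma subspace_algebroid_fibre:
  assumes G: "lie_groupoid G" and q: "q \<in> points (obj G)"
  shows "subspace (algebroid_fibre G q)"
  unfolding algebroid_fibre_def
  by (intro linear_subspace_kernel linear_tangent_map lie_groupoid_props[OF G]
      idn_in_points[OF G q])

lemma idn_in_algebroid_iff:
  assumes G: "lie_groupoid G" and q: "q \<in> points (obj G)"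
  shows "(idn G q, v) \<in> algebroid G \<longleftrightarrow> v \<in> algebroid_fibre G q"
proof
  assume "(idn G q, v) \<in> algebroid G"
  then obtain q' where q': "q' \<in> points (obj G)" "idn G q = idn G q'" "v \<in> algebroid_fibre G q'"
    unfolding algebroid_def by blast
  have "q = src G (idn G q)" by (rule lie_groupoid_src_idn[OF G q, symmetric])
  also have "\<dots> = src G (idn G q')" by (rule arg_cong[OF q'(2)])
  also have "\<dots> = q'" by (rule lie_groupoid_src_idn[OF G q'(1)])
  finally show "v \<in> algebroid_fibre G q" using q'(3) by (simp only:)
qed (use q in \<open>auto simp: algebroid_def\<close>)

lemma vertical_lift_eq [simp]: "vertical_lift v = v"
proof -
  have "((\<lambda>t::real. t *\<^sub>R v) has_vector_derivative v) (at 0)"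
    by (auto intro!: derivative_eq_intros)
  then show ?thesis unfolding vertical_lift_def by (rule vector_derivative_at)
qed

lemma fibre_tangent_map_has_vector_derivative:
  assumes G: "lie_groupoid G" and q: "q \<in> points (obj G)"
    and R: "smooth_on_subset (tangent_bundle (arr G)) (algebroid G) (arr G) R"
    and R0: "R (idn G q, 0) = idn G q" and v: "v \<in> algebroid_fibre G q"
  shows "((\<lambda>t. coord_at (arr G) (idn G q) (R (idn G q, t *\<^sub>R v))) has_vector_derivative
           fibre_tangent_map G R q v) (at 0)"
proof (rule has_derivative_within_subspace_line)
  note sub = subspace_algebroid_fibre[OF G q]
  show "subspace (algebroid_fibre G q)" by (fact sub)
  have "(\<lambda>w. coord_at (arr G) (R (idn G q, 0)) (R (idn G q, w))) differentiable
      (at 0 within {w. (idn G q, w) \<in> algebroid G})"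
    by (rule fibre_differentiable[OF _ _ R])
      (use R0 lie_groupoid_arr[OF G] idn_in_points[OF G q] subspace_0[OF sub]
        in \<open>simp_all add: idn_in_algebroid_iff[OF G q]\<close>)
  then show "((\<lambda>w. coord_at (arr G) (idn G q) (R (idn G q, w))) has_derivative
      fibre_tangent_map G R q) (at 0 within algebroid_fibre G q)"
    unfolding fibre_tangent_map_def zero_section_def
    by (simp add: R0 idn_in_algebroid_iff[OF G q] frechet_derivative_works)
qed (fact v)

text \<open>
  Both sides are the velocity at \<open>t = 0\<close> of the curve \<open>R' (t A\<Psi> w) = \<Psi> (R (t w))\<close>: the left one
  computes it within the fibre of the target, the right one by the chain rule through \<open>\<Psi>\<close>.
\<close>

lemma fibre_derivative_naturality:
  assumes G: "lie_groupoid G" and G': "lie_groupoid G'"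
    and mor: "groupoid_morphism G G' \<Psi> \<psi>"
    and R: "smooth_on_subset (tangent_bundle (arr G)) (algebroid G) (arr G) R"
    and R': "smooth_on_subset (tangent_bundle (arr G')) (algebroid G') (arr G') R'"
    and q: "q \<in> points (obj G)"
    and R0: "R (idn G q, 0) = idn G q"
    and inter: "\<And>w. w \<in> algebroid_fibre G q \<Longrightarrow>
          R' (bundle_map (arr G) (arr G') \<Psi> (idn G q, w)) = \<Psi> (R (idn G q, w))"
    and w: "w \<in> algebroid_fibre G q"
    and w': "tangent_map (arr G) (arr G') \<Psi> (idn G q) w \<in> algebroid_fibre G' (\<psi> q)"
  shows "fibre_tangent_map G' R' (\<psi> q) (tangent_map (arr G) (arr G') \<Psi> (idn G q) w) =
           tangent_map (arr G) (arr G') \<Psi> (idn G q) (fibre_tangent_map G R q w)"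
proof -
  let ?M = "arr G" and ?N = "arr G'" and ?p = "idn G q"
  let ?L = "tangent_map ?M ?N \<Psi> ?p"
  note M = lie_groupoid_arr[OF G] and N = lie_groupoid_arr[OF G']
  have p: "?p \<in> points ?M" by (rule idn_in_points[OF G q])
  have \<Psi>: "smooth_map ?M ?N \<Psi>" and \<psi>: "smooth_map (obj G) (obj G') \<psi>"
    and \<Psi>p: "\<Psi> ?p = idn G' (\<psi> q)"
    using mor q unfolding groupoid_morphism_def by auto
  have q': "\<psi> q \<in> points (obj G')" by (rule smooth_map_in_points[OF \<psi> q])
  have L: "linear ?L" by (rule linear_tangent_map[OF M N \<Psi> p])
  note sub = subspace_algebroid_fibre[OF G q]
  have tw: "t *\<^sub>R w \<in> algebroid_fibre G q" for t by (rule subspace_scale[OF sub w])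
  have inter': "R' (idn G' (\<psi> q), t *\<^sub>R ?L w) = \<Psi> (R (?p, t *\<^sub>R w))" for t
    using inter[OF tw, of t] L by (simp add: bundle_map_def \<Psi>p linear_cmul)
  have R0': "R' (idn G' (\<psi> q), 0) = idn G' (\<psi> q)"
    using inter'[of 0] R0 \<Psi>p by simp
  let ?c = "\<lambda>t::real. coord_at ?M ?p (R (?p, t *\<^sub>R w))"
  let ?c' = "\<lambda>t::real. coord_at ?N (idn G' (\<psi> q)) (R' (idn G' (\<psi> q), t *\<^sub>R ?L w))"
  let ?F = "coord_at ?N (\<Psi> ?p) \<circ> \<Psi> \<circ> coord_inv_at ?M ?p"
  have c: "(?c has_vector_derivative fibre_tangent_map G R q w) (at 0)"
    by (rule fibre_tangent_map_has_vector_derivative[OF G q R R0 w])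
  have c': "(?c' has_vector_derivative fibre_tangent_map G' R' (\<psi> q) (?L w)) (at 0)"
    by (rule fibre_tangent_map_has_vector_derivative[OF G' q' R' R0' w'])
  have "?c 0 = coord_at ?M ?p ?p" using R0 by simp
  then have "(?F has_derivative ?L) (at (?c 0))"
    using tangent_map_has_derivative[OF M N \<Psi> p] by (simp only:)
  from diff_chain_at[OF c[unfolded has_vector_derivative_def] this]
  have Fc: "(?F \<circ> ?c has_vector_derivative ?L (fibre_tangent_map G R q w)) (at 0)"
    using L by (simp add: has_vector_derivative_def o_def linear_cmul)
  \<comment> \<open>Near \<open>t = 0\<close> the curve stays in the chart at the identity arrow, where it can be recovered
    from its coordinates.\<close>
  have "\<forall>\<^sub>F w in nhds 0. (?p, w) \<in> algebroid G \<longrightarrow> R (?p, w) \<in> fst (chart_at ?M ?p)"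
    by (rule smooth_on_subset_eventually_in[OF M R p])
      (use R0 chart_at_openin[OF M p] chart_at_contains[OF M p] subspace_0[OF sub]
        in \<open>simp_all add: idn_in_algebroid_iff[OF G q]\<close>)
  moreover have "filterlim (\<lambda>t::real. t *\<^sub>R w) (nhds 0) (nhds 0)"
    using tendsto_scaleR[OF filterlim_ident[of "nhds 0"] tendsto_const[of w]] by simp
  ultimately have "\<forall>\<^sub>F t::real in nhds 0. (?p, t *\<^sub>R w) \<in> algebroid G \<longrightarrow>
      R (?p, t *\<^sub>R w) \<in> fst (chart_at ?M ?p)"
    by (rule eventually_compose_filterlim)
  then have eq: "\<forall>\<^sub>F t in nhds 0. (?F \<circ> ?c) t = ?c' t"
    by eventually_elim
      (use M p tw in \<open>simp add: idn_in_algebroid_iff[OF G q] inter' \<Psi>p\<close>)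
  then have "\<forall>\<^sub>F t in nhds 0. t \<in> UNIV \<longrightarrow> (?F \<circ> ?c) t = ?c' t"
    by eventually_elim (rule impI)
  from has_vector_derivative_cong_ev[OF this eventually_nhds_x_imp_x[OF eq]] Fc
  have "(?c' has_vector_derivative ?L (fibre_tangent_map G R q w)) (at 0)" by (rule iffD1)
  with c' show ?thesis by (rule vector_derivative_unique_at)
qed

text \<open>
  The chain rule applied to \<open>\<Psi> \<circ> \<epsilon> = \<epsilon>' \<circ> \<psi>\<close> and \<open>\<psi> \<circ> \<alpha> = \<alpha>' \<circ> \<Psi>\<close>. This moves \<open>T\<Psi>\<close> past the
  correction term of the discretization condition.
\<close>

lemma groupoid_morphism_tangent_idn_src:
  assumes G: "lie_groupoid G" and G': "lie_groupoid G'"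
    and mor: "groupoid_morphism G G' \<Psi> \<psi>" and q: "q \<in> points (obj G)"
  shows "tangent_map (arr G) (arr G') \<Psi> (idn G q)
           (tangent_map (obj G) (arr G) (idn G) q
             (tangent_map (arr G) (obj G) (src G) (idn G q) x)) =
         tangent_map (obj G') (arr G') (idn G') (\<psi> q)
           (tangent_map (arr G') (obj G') (src G') (idn G' (\<psi> q))
             (tangent_map (arr G) (arr G') \<Psi> (idn G q) x))"
proof -
  note g = lie_groupoid_props[OF G] and g' = lie_groupoid_props[OF G']
  have p: "idn G q \<in> points (arr G)" by (rule idn_in_points[OF G q])
  have \<Psi>: "smooth_map (arr G) (arr G') \<Psi>" and \<psi>: "smooth_map (obj G) (obj G') \<psi>"
    and src: "\<And>g. g \<in> points (arr G) \<Longrightarrow> src G' (\<Psi> g) = \<psi> (src G g)"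
    and idn: "\<And>q. q \<in> points (obj G) \<Longrightarrow> \<Psi> (idn G q) = idn G' (\<psi> q)"
    using mor unfolding groupoid_morphism_def by auto
  have idn_nat: "tangent_map (arr G) (arr G') \<Psi> (idn G q) (tangent_map (obj G) (arr G) (idn G) q y) =
      tangent_map (obj G') (arr G') (idn G') (\<psi> q) (tangent_map (obj G) (obj G') \<psi> q y)" for y
    using tangent_map_chain[OF g(2,1) g'(1) g(4) \<Psi> refl q]
      tangent_map_chain[OF g(2) g'(2,1) \<psi> g'(4) idn q] by simp
  have "tangent_map (obj G) (obj G') \<psi> q (tangent_map (arr G) (obj G) (src G) (idn G q) x) =
      tangent_map (arr G') (obj G') (src G') (idn G' (\<psi> q))
        (tangent_map (arr G) (arr G') \<Psi> (idn G q) x)"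
    using tangent_map_chain[OF g(1,2) g'(2) g(3) \<psi> src p, of x]
      tangent_map_chain[OF g(1) g'(1,2) \<Psi> g'(3) refl p, of x] idn[OF q] g(5)[OF q] by simp
  with idn_nat show ?thesis by simp
qed


section \<open>Descent to the quotient\<close>

text \<open>
  Every vector \<open>u\<close> over \<open>q'\<close> is \<open>T\<Psi> w\<close> for some \<open>w\<close>, over an object \<open>q\<close> with \<open>\<psi> q = q'\<close> that may vary
  with \<open>u\<close>. The condition for \<open>w\<close> is carried to \<open>u\<close> by the two lemmas above, and the zero section is
  treated in the same way with \<open>w = 0\<close>.
\<close>

lemma generalized_discretization_map_descends:
  assumes G: "lie_groupoid G" and G': "lie_groupoid G'"
    and mor: "groupoid_morphism G G' \<Psi> \<psi>"
    and R: "generalized_discretization_map G R"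
    and R': "smooth_on_subset (tangent_bundle (arr G')) (algebroid G') (arr G') R'"
    and obj: "\<psi> ` points (obj G) = points (obj G')"
    and alg: "bundle_map (arr G) (arr G') \<Psi> ` algebroid G = algebroid G'"
    and inter: "\<And>w. w \<in> algebroid G \<Longrightarrow> R' (bundle_map (arr G) (arr G') \<Psi> w) = \<Psi> (R w)"
  shows "generalized_discretization_map G' R'"
proof -
  let ?T = "\<lambda>q. tangent_map (arr G) (arr G') \<Psi> (idn G q)"
  have Rs: "smooth_on_subset (tangent_bundle (arr G)) (algebroid G) (arr G) R"
    and R0: "\<And>q. q \<in> points (obj G) \<Longrightarrow> R (idn G q, 0) = idn G q"
    and Rd: "\<And>q v. q \<in> points (obj G) \<Longrightarrow> v \<in> algebroid_fibre G q \<Longrightarrow>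
        fibre_tangent_map G R q v = v + tangent_map (obj G) (arr G) (idn G) q
          (tangent_map (arr G) (obj G) (src G) (idn G q) (fibre_tangent_map G R q v))"
    using R unfolding generalized_discretization_map_def zero_section_def by auto
  have \<Psi>: "smooth_map (arr G) (arr G') \<Psi>"
    and idn: "\<And>q. q \<in> points (obj G) \<Longrightarrow> \<Psi> (idn G q) = idn G' (\<psi> q)"
    using mor unfolding groupoid_morphism_def by auto
  have lin: "linear (?T q)" if "q \<in> points (obj G)" for q
    by (rule linear_tangent_map[OF lie_groupoid_arr[OF G] lie_groupoid_arr[OF G'] \<Psi>
          idn_in_points[OF G that]])
  have inter': "R' (idn G' (\<psi> q), ?T q w) = \<Psi> (R (idn G q, w))"
    if "q \<in> points (obj G)" "w \<in> algebroid_fibre G q" for q w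
    using inter[of "(idn G q, w)"] that idn by (simp add: idn_in_algebroid_iff[OF G] bundle_map_def)
  have zero: "R' (zero_section G' q') = idn G' q'" if "q' \<in> points (obj G')" for q'
  proof -
    have "q' \<in> \<psi> ` points (obj G)" by (simp only: obj that)
    then obtain q where q: "q \<in> points (obj G)" "q' = \<psi> q" by (elim imageE)
    have "R' (zero_section G' q') = R' (idn G' (\<psi> q), ?T q 0)"
      by (simp only: zero_section_def q(2) linear_0[OF lin[OF q(1)]])
    also have "\<dots> = \<Psi> (R (idn G q, 0))"
      by (rule inter'[OF q(1) subspace_0[OF subspace_algebroid_fibre[OF G q(1)]]])
    also have "\<dots> = idn G' q'"
      by (simp only: R0[OF q(1)] idn[OF q(1)] q(2))
    finally show ?thesis .
  qed
  have deriv: "fibre_tangent_map G' R' q' u = u + tangent_map (obj G') (arr G') (idn G') q'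
      (tangent_map (arr G') (obj G') (src G') (idn G' q') (fibre_tangent_map G' R' q' u))"
    if q': "q' \<in> points (obj G')" and u: "u \<in> algebroid_fibre G' q'" for q' u
  proof -
    have "(idn G' q', u) \<in> bundle_map (arr G) (arr G') \<Psi> ` algebroid G"
      using alg u idn_in_algebroid_iff[OF G' q'] by simp
    then obtain q w where q: "q \<in> points (obj G)" and w: "w \<in> algebroid_fibre G q"
      and eq: "(idn G' q', u) = bundle_map (arr G) (arr G') \<Psi> (idn G q, w)"
      unfolding algebroid_def by blast
    from eq have i: "idn G' q' = idn G' (\<psi> q)" and uw: "u = ?T q w"
      using idn[OF q] by (auto simp: bundle_map_def)
    have "\<psi> q \<in> points (obj G')" unfolding obj[symmetric] by (rule imageI[OF q])
    then have "src G' (idn G' (\<psi> q)) = \<psi> q" by (rule lie_groupoid_src_idn[OF G'])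
    then have qq: "q' = \<psi> q"
      using lie_groupoid_src_idn[OF G' q', unfolded i] by (rule trans[OF sym, rotated])
    have nat: "fibre_tangent_map G' R' q' u = ?T q (fibre_tangent_map G R q w)"
      unfolding uw qq
      by (rule fibre_derivative_naturality[OF G G' mor Rs R' q R0[OF q] _ w])
        (use u uw qq q idn inter' in \<open>auto simp: bundle_map_def\<close>)
    also have "\<dots> = ?T q (w + tangent_map (obj G) (arr G) (idn G) q
        (tangent_map (arr G) (obj G) (src G) (idn G q) (fibre_tangent_map G R q w)))"
      using Rd[OF q w] by simp
    also have "\<dots> = u + tangent_map (obj G') (arr G') (idn G') q'
        (tangent_map (arr G') (obj G') (src G') (idn G' q') (?T q (fibre_tangent_map G R q w)))"
      by (simp add: linear_add[OF lin[OF q]] groupoid_morphism_tangent_idn_src[OF G G' mor q] uw qq)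
    finally show ?thesis by (simp add: nat)
  qed
  show ?thesis
    unfolding generalized_discretization_map_def using R' zero deriv by simp
qed

theorem theorem4p3:
  fixes H :: "'h monoid" and MH :: "('h, 'k::real_normed_vector) smfd"
    and G :: "('g, 'e::real_normed_vector, 'q, 'f::real_normed_vector) groupoid_data"
    and \<Phi> :: "'h \<Rightarrow> 'g \<Rightarrow> 'g" and \<phi> :: "'h \<Rightarrow> 'q \<Rightarrow> 'q"
    and R :: "'g \<times> 'e \<Rightarrow> 'g"
    and Ghat :: "('g set, 'e2::real_normed_vector, 'q set, 'f2::real_normed_vector) groupoid_data"
    and \<iota> :: "('g \<times> 'e) set \<Rightarrow> 'g set \<times> 'e2"
    and Rhat :: "('g \<times> 'e) set \<Rightarrow> 'g set"
  defines "AGhat \<equiv> orbit_space H (algebroid_action G \<Phi>) (algebroid G)"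
    and "\<pi>AG \<equiv> orbit_proj H (algebroid_action G \<Phi>)"
    and "\<pi>G \<equiv> orbit_proj H \<Phi>"
  assumes "lie_groupoid G"
    and "lie_group H MH"
    and "free_proper_groupoid_action H MH G \<Phi> \<phi>"
    and "generalized_discretization_map G R"
    and equivariant: "\<And>h w. h \<in> carrier H \<Longrightarrow> w \<in> algebroid G \<Longrightarrow>
           R (algebroid_action G \<Phi> h w) = \<Phi> h (R w)"
    and "quotient_lie_groupoid H \<Phi> \<phi> G Ghat"
    and "quotient_algebroid_identification H \<Phi> G Ghat \<iota>"
    and Rhat_smooth: "smooth_on_subset (tangent_bundle (arr Ghat)) (algebroid Ghat) (arr Ghat)
           (Rhat \<circ> inv_into AGhat \<iota>)"
    and Rhat_induced: "\<And>w. w \<in> algebroid G \<Longrightarrow> Rhat (\<pi>AG w) = \<pi>G (R w)"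
  shows "generalized_discretization_map Ghat (Rhat \<circ> inv_into AGhat \<iota>)"
proof (rule generalized_discretization_map_descends)
  show "lie_groupoid G" by fact
  show "lie_groupoid Ghat" "groupoid_morphism G Ghat \<pi>G (orbit_proj H \<phi>)"
    "orbit_proj H \<phi> ` points (obj G) = points (obj Ghat)"
    using \<open>quotient_lie_groupoid H \<Phi> \<phi> G Ghat\<close>
    unfolding quotient_lie_groupoid_def quotient_manifold_def orbit_space_def \<pi>G_def by auto
  show "generalized_discretization_map G R" by fact
  show "smooth_on_subset (tangent_bundle (arr Ghat)) (algebroid Ghat) (arr Ghat)
      (Rhat \<circ> inv_into AGhat \<iota>)" by fact
  have bij: "bij_betw \<iota> AGhat (algebroid Ghat)"
    and \<iota>: "\<And>w. w \<in> algebroid G \<Longrightarrow> \<iota> (\<pi>AG w) = bundle_map (arr G) (arr Ghat) \<pi>G w"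
    using \<open>quotient_algebroid_identification H \<Phi> G Ghat \<iota>\<close>
    unfolding quotient_algebroid_identification_def AGhat_def \<pi>AG_def \<pi>G_def by auto
  have AGhat: "AGhat = \<pi>AG ` algebroid G"
    unfolding AGhat_def \<pi>AG_def orbit_space_def ..
  have "bundle_map (arr G) (arr Ghat) \<pi>G ` algebroid G = \<iota> ` AGhat"
    unfolding AGhat image_image by (rule image_cong) (simp_all add: \<iota>)
  then show "bundle_map (arr G) (arr Ghat) \<pi>G ` algebroid G = algebroid Ghat"
    using bij by (simp add: bij_betw_def)
  show "(Rhat \<circ> inv_into AGhat \<iota>) (bundle_map (arr G) (arr Ghat) \<pi>G w) = \<pi>G (R w)"
    if w: "w \<in> algebroid G" for w
  proof -
    have "inv_into AGhat \<iota> (\<iota> (\<pi>AG w)) = \<pi>AG w"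
      using bij w by (intro bij_betw_inv_into_left) (auto simp: AGhat)
    then show ?thesis using \<iota>[OF w] Rhat_induced[OF w] by simp
  qed
qed

end
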